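(* Let $k\in\mathbb{Z}$, let $n\ge 0$ be an integer, and let $x,y\in\mathbb{C}$. For every nonzero $\lambda\in\mathbb{C}$, $$\beta_{n,\lambda}^{(k)}(x+y)=\sum_{l=0}^{n}\binom{n}{l}\left(\frac{y}{\lambda}\right)_{n-l}\lambda^{n-l}\,\beta_{l,\lambda}^{(k)}(x),$$ and moreover $$\lim_{\lambda\to 0}\beta_{n,\lambda}^{(k)}(x)=B_{n}^{(k)}(x).$$
   Context: For $k\in\mathbb{Z}$, the polylogarithm is the power series $\mathrm{Li}_k(u)=\sum_{n=1}^{\infty}\frac{u^n}{n^k}$. For nonzero $\lambda$, the fully degenerate poly-Bernoulli polynomials $\beta_{n,\lambda}^{(k)}(x)$ are defined by the generating function (identity of formal power series in $t$) $$\frac{\mathrm{Li}_{k}\left(1-(1+\lambda t)^{-1/\lambda}\right)}{1-(1+\lambda t)^{-1/\lambda}}(1+\lambda t)^{x/\lambda}=\sum_{n=0}^{\infty}\beta_{n,\lambda}^{(k)}(x)\frac{t^{n}}{n!},$$ where $(1+\lambda t)^{a}=\sum_{j\ge0}(a)_j\lambda^j\frac{t^j}{j!}$ and $\mathrm{Li}_k(u)/u$ denotes the series $\sum_{m\ge 0}u^m/(m+1)^k$. The poly-Bernoulli polynomials $B_n^{(k)}(x)$ are defined by $$\frac{\mathrm{Li}_{k}(1-e^{-t})}{1-e^{-t}}e^{xt}=\sum_{n=0}^{\infty}B_{n}^{(k)}(x)\frac{t^{n}}{n!}.$$ Here $(a)_n=a(a-1)\cdots(a-n+1)$ with $(a)_0=1$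 is the falling factorial. The limit is taken through nonzero $\lambda$. *)

theory Defs
  imports Complex_Main "HOL-Computational_Algebra.Formal_Power_Series"
begin

definition falling_fact :: "complex \<Rightarrow> nat \<Rightarrow> complex" where
  "falling_fact a n = (\<Prod>i<n. a - of_nat i)"

(* The formal power series (1 + lam t)^a in t. *)
definition fps_degen_power :: "complex \<Rightarrow> complex \<Rightarrow> complex fps" where
  "fps_degen_power lam a = Abs_fps (\<lambda>j. falling_fact a j * lam ^ j / fact j)"

definition fps_polylog :: "int \<Rightarrow> complex fps" where
  "fps_polylog k = Abs_fps (\<lambda>n. if n = 0 then 0 else 1 / of_nat n powi k)"

(* Li_k(u) / u as a power series in u; see fps_polylog_quot_compose for its
   agreement with the quotient of power series after substitution. *)
definition fps_polylog_quot :: "int \<Rightarrow> complex fps" where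
  "fps_polylog_quot k = Abs_fps (\<lambda>m. 1 / of_nat (m + 1) powi k)"

lemma fps_polylog_eq: "fps_polylog k = fps_polylog_quot k * fps_X"
  by (rule fps_ext) (simp add: fps_polylog_def fps_polylog_quot_def)

lemma fps_polylog_quot_compose:
  assumes "fps_nth u 0 = 0" and "u \<noteq> 0"
  shows "(fps_polylog k oo u) / u = fps_polylog_quot k oo u"
proof -
  have "fps_polylog k oo u = (fps_polylog_quot k oo u) * u"
    using assms(1) by (simp add: fps_polylog_eq fps_compose_mult_distrib)
  then show ?thesis using assms(2) by simp
qed

(* In the two generating functions below, the inner series of oo has constant
   term 0, so oo is the genuine substitution of power series. *)

definition degen_poly_bernoulli_gf :: "int \<Rightarrow> complex \<Rightarrow> complex \<Rightarrow> complex fps" where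
  "degen_poly_bernoulli_gf k lam x =
     (fps_polylog_quot k oo (1 - fps_degen_power lam (- 1 / lam))) * fps_degen_power lam (x / lam)"

definition degen_poly_bernoulli :: "int \<Rightarrow> nat \<Rightarrow> complex \<Rightarrow> complex \<Rightarrow> complex" where
  "degen_poly_bernoulli k n lam x = fact n * fps_nth (degen_poly_bernoulli_gf k lam x) n"

definition poly_bernoulli_gf :: "int \<Rightarrow> complex \<Rightarrow> complex fps" where
  "poly_bernoulli_gf k x = (fps_polylog_quot k oo (1 - fps_exp (- 1))) * fps_exp x"

definition poly_bernoulli :: "int \<Rightarrow> nat \<Rightarrow> complex \<Rightarrow> complex" where
  "poly_bernoulli k n x = fact n * fps_nth (poly_bernoulli_gf k x) n"

lemma degen_poly_bernoulli_gf_eq: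
  "degen_poly_bernoulli_gf k lam x = Abs_fps (\<lambda>n. degen_poly_bernoulli k n lam x / fact n)"
  by (rule fps_ext) (simp add: degen_poly_bernoulli_def)

lemma poly_bernoulli_gf_eq:
  "poly_bernoulli_gf k x = Abs_fps (\<lambda>n. poly_bernoulli k n x / fact n)"
  by (rule fps_ext) (simp add: poly_bernoulli_def)

lemma inner_series_nth_0:
  "fps_nth (1 - fps_degen_power lam a) 0 = 0" "fps_nth (1 - fps_exp (- 1 :: complex)) 0 = 0"
  by (simp_all add: fps_degen_power_def falling_fact_def)

lemma inner_series_nonzero:
  "lam \<noteq> 0 \<Longrightarrow> 1 - fps_degen_power lam (- 1 / lam) \<noteq> 0" "1 - fps_exp (- 1 :: complex) \<noteq> 0"
proof -
  assume "lam \<noteq> 0"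
  then have "fps_nth (1 - fps_degen_power lam (- 1 / lam)) 1 \<noteq> 0"
    by (simp add: fps_degen_power_def falling_fact_def)
  then show "1 - fps_degen_power lam (- 1 / lam) \<noteq> 0" by (metis fps_zero_nth)
next
  have "fps_nth (1 - fps_exp (- 1 :: complex)) 1 \<noteq> 0" by simp
  then show "1 - fps_exp (- 1 :: complex) \<noteq> 0" by (metis fps_zero_nth)
qed

end

(* The coefficient of t^j in (1 + lam t)^(a/lam) is a (a - lam) ... (a - (j-1) lam) / j!, which is
   polynomial in lam and equals a^j / j! at lam = 0.  Since a coefficient of a product or a
   composition of power series depends polynomially on finitely many coefficients of the factors,
   the limit can be taken coefficientwise.  The addition formula is the coefficient form of
   (1 + lam t)^((x+y)/lam) = (1 + lam t)^(x/lam) (1 + lam t)^(y/lam). *)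
theory Submission
  imports Defs
begin

text \<open>Substituting \<open>lam * t\<close> for \<open>t\<close> scales the j-th binomial
  coefficient by \<open>lam ^ j\<close>. This form makes the exponent law of
  \<open>fps_binomial\<close> available.\<close>

lemma fps_degen_power_eq_fps_binomial:
  "fps_degen_power lam a = fps_binomial a oo (fps_const lam * fps_X)"
  by (rule fps_ext)
    (simp add: fps_compose_linear fps_degen_power_def falling_fact_def gbinomial_prod_rev
      atLeast0LessThan)

lemma fps_degen_power_add:
  "fps_degen_power lam (a + b) = fps_degen_power lam a * fps_degen_power lam b"
  by (simp add: fps_degen_power_eq_fps_binomial fps_binomial_add_mult fps_compose_mult_distrib)

lemma degen_poly_bernoulli_gf_add:
  "degen_poly_bernoulli_gf k lam (x + y) =
     degen_poly_bernoulli_gf k lam x * fps_degen_power lam (y / lam)"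
  by (simp add: degen_poly_bernoulli_gf_def add_divide_distrib fps_degen_power_add mult.assoc)

lemma degen_poly_bernoulli_add:
  "degen_poly_bernoulli k n lam (x + y) =
     (\<Sum>l = 0..n. of_nat (n choose l) * falling_fact (y / lam) (n - l) * lam ^ (n - l)
        * degen_poly_bernoulli k l lam x)"
  unfolding degen_poly_bernoulli_def degen_poly_bernoulli_gf_add fps_mult_nth sum_distrib_left
  \<comment> \<open>The factor n! turns 1 / (l! (n-l)!) into the binomial coefficient.\<close>
  by (rule sum.cong) (simp_all add: fps_degen_power_def binomial_fact)

lemma tendsto_fps_mult_nth:
  fixes F G :: "'b \<Rightarrow> 'a :: real_normed_algebra_1 fps"
  assumes "\<And>n. ((\<lambda>z. fps_nth (F z) n) \<longlongrightarrow> fps_nth f n) A"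
    and "\<And>n. ((\<lambda>z. fps_nth (G z) n) \<longlongrightarrow> fps_nth g n) A"
  shows "((\<lambda>z. fps_nth (F z * G z) n) \<longlongrightarrow> fps_nth (f * g) n) A"
  unfolding fps_mult_nth by (intro tendsto_intros assms)

lemma tendsto_fps_power_nth:
  fixes F :: "'b \<Rightarrow> 'a :: real_normed_algebra_1 fps"
  assumes "\<And>n. ((\<lambda>z. fps_nth (F z) n) \<longlongrightarrow> fps_nth f n) A"
  shows "((\<lambda>z. fps_nth (F z ^ m) n) \<longlongrightarrow> fps_nth (f ^ m) n) A"
proof (induction m arbitrary: n)
  case (Suc m)
  then show ?case unfolding power_Suc by (intro tendsto_fps_mult_nth assms)
qed simp

text \<open>The n-th coefficient of a composition is a finite sum over i \<le> n of the i-th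
  coefficient of \<open>f\<close> times the n-th coefficient of the i-th power of the inner
  series.\<close>

lemma tendsto_fps_compose_nth:
  fixes G :: "'b \<Rightarrow> 'a :: real_normed_algebra_1 fps"
  assumes "\<And>n. ((\<lambda>z. fps_nth (G z) n) \<longlongrightarrow> fps_nth g n) A"
  shows "((\<lambda>z. fps_nth (f oo G z) n) \<longlongrightarrow> fps_nth (f oo g) n) A"
  unfolding fps_compose_nth by (intro tendsto_intros tendsto_fps_power_nth assms)

text \<open>Giving one \<open>lam\<close> to each factor clears the denominators and leaves an
  expression continuous at 0.\<close>

lemma falling_fact_mult_power:
  assumes "lam \<noteq> 0"
  shows "falling_fact (a / lam) j * lam ^ j = (\<Prod>i<j. a - of_nat i * lam)"
proof -
  have "falling_fact (a / lam) j * lam ^ j = (\<Prod>i<j. (a / lam - of_nat i) * lam)"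
    by (simp add: falling_fact_def prod.distrib)
  also have "\<dots> = (\<Prod>i<j. a - of_nat i * lam)"
    using assms by (intro prod.cong) (simp_all add: left_diff_distrib)
  finally show ?thesis .
qed

lemma tendsto_fps_degen_power_nth:
  "((\<lambda>lam. fps_nth (fps_degen_power lam (a / lam)) j) \<longlongrightarrow> fps_nth (fps_exp a) j) (at 0)"
proof -
  have "((\<lambda>lam. (\<Prod>i<j. a - of_nat i * lam) / fact j) \<longlongrightarrow>
      (\<Prod>i<j. a - of_nat i * 0) / fact j) (at 0)"
    by (intro tendsto_intros) simp_all
  \<comment> \<open>The filter \<open>at 0\<close> excludes 0 itself, so the denominators can be
    cleared.\<close>
  moreover have "\<forall>\<^sub>F lam in at 0.
      (\<Prod>i<j. a - of_nat i * lam) / fact j = fps_nth (fps_degen_power lam (a / lam)) j"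
    by (rule eventually_mono[OF eventually_neq_at_within[of 0]])
      (simp add: fps_degen_power_def falling_fact_mult_power)
  ultimately show ?thesis
    by (auto intro: Lim_transform_eventually)
qed

lemma tendsto_degen_poly_bernoulli:
  "((\<lambda>lam. degen_poly_bernoulli k n lam x) \<longlongrightarrow> poly_bernoulli k n x) (at 0)"
  unfolding degen_poly_bernoulli_def poly_bernoulli_def degen_poly_bernoulli_gf_def
    poly_bernoulli_gf_def
proof (intro tendsto_mult_left tendsto_fps_mult_nth tendsto_fps_compose_nth
    tendsto_fps_degen_power_nth)
  \<comment> \<open>The inner series remains; its limit is the case a = -1 of the coefficient
    limit.\<close>
  show "((\<lambda>lam. fps_nth (1 - fps_degen_power lam (- 1 / lam)) m) \<longlongrightarrow>
      fps_nth (1 - fps_exp (- 1)) m) (at 0)" for m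
    unfolding fps_sub_nth by (intro tendsto_intros tendsto_fps_degen_power_nth)
qed

theorem theorem1:
  fixes k :: int and n :: nat and x y :: complex
  shows "(\<forall>lam :: complex. lam \<noteq> 0 \<longrightarrow>
            degen_poly_bernoulli k n lam (x + y) =
              (\<Sum>l = 0..n. of_nat (n choose l) * falling_fact (y / lam) (n - l) * lam ^ (n - l)
                 * degen_poly_bernoulli k l lam x)) \<and>
         ((\<lambda>lam. degen_poly_bernoulli k n lam x) \<longlongrightarrow> poly_bernoulli k n x) (at 0)"
  using degen_poly_bernoulli_add tendsto_degen_poly_bernoulli by blast

end
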